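(* Let $\mathbb{F}_q$ be a finite field, let $H$ be a subgroup of $\mathbb{F}_q^\times$, and let $\chi\colon H\to\mathbb{C}^\times$ be a character of $H$. Let $R,S$ be sets of representatives of the $H$-orbits of $\mathbb{F}_q$ (if $\chi$ is trivial) or of $\mathbb{F}_q^\times$ (if $\chi$ is nontrivial), and let $M$ be a $(\chi,R,S)$-compressed Fourier matrix. Then $(\mathbb{F}_q,\chi)$ has the strong uncertainty property if and only if $M$ has the nonvanishing minors property.
   Context: $\mathbb{F}_q$ is the finite field of order $q$ and characteristic $p$, with absolute trace $\operatorname{Tr}\colon\mathbb{F}_q\to\mathbb{F}_p$. Let $\epsilon(x)=\exp(2\pi i\operatorname{Tr}(x)/p)$ and, for $a\in\mathbb{F}_q$, $\epsilon_a(x)=\epsilon(ax)$. Then $\widehat{\mathbb{F}}_q=\{\epsilon_a:a\in\mathbb{F}_q\}$ is the group of all additive characters $\mathbb{F}_q\to\mathbb{C}^\times$ ($\epsilon_0$ is trivial). $\mathbb{C}[\mathbb{F}_q]$ is the group ring of the additive group; its elements $f=\sum_{a\in\mathbb{F}_q}f_a[a]$ are identified with functions $a\mapsto f(a)=f_a$, and $\operatorname{supp}(f)=\{a:f_a\ne0\}$. Additive characters are extended linearly: $\psi(f)=\sum_a f_a\psi(a)$. The Fourier transform of $f$ is $\widehat f\colon\widehat{\mathbb{F}}_q\to\mathbb{C}$, $\widehat f(\psi)=\psi(f)$, with support $\{\psi:\widehat f(\psi)\neq0\}$. $H$ acts on $\mathbb{F}_q$ by multiplication; the $H$-orbits are $\{0\}$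 and the cosets of $H$ in $\mathbb{F}_q^\times$. A set of representatives contains exactly one element of each orbit. A character of $H$ is a group homomorphism $\chi\colon H\to\mathbb{C}^\times$ (trivial if identically $1$). An element $f\in\mathbb{C}[\mathbb{F}_q]$ is $\chi$-symmetric if $f_{ha}=\chi(h)f_a$ for all $h\in H$, $a\in\mathbb{F}_q$. $(\mathbb{F}_q,\chi)$ has the strong uncertainty property if every nonzero $\chi$-symmetric $f\in\mathbb{C}[\mathbb{F}_q]$ satisfies: if $\chi$ is nontrivial, $|\operatorname{supp}(f)|+|\operatorname{supp}(\widehat f)|\ge q+|H|-1$; if $\chi$ is trivial, $|\operatorname{supp}(f)|+|\operatorname{supp}(\widehat f)|$ is at least $q+2|H|-1$ if $f(0)=0$ and $\widehat f(\epsilon_0)=0$, at least $q+|H|$ if exactly one of $f(0)$, $\widehat f(\epsilon_0)$ is $0$, and at least $q+1$ otherwise. For $r\in\mathbb{F}_q$ let $u_{\chi,r}=\sum_{h\in H}\chi(h)[hr]$. A $(\chi,R,S)$-compressed Fourier matrix is a matrix whose rows and columns are indexed respectively by $R$ and $S$ (endowed with some orderings) and whose $(r,s)$-entry is $\epsilon_s(u_{\chi,r})$. A square matrix has the nonvanishing minors property if the determinant of every square submatrix (obtained by choosing any set of $k$ rows and any set of $k$ columns, $k\ge 1$) is nonzero. *)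

theory Defs
  imports
    "HOL-Algebra.Multiplicative_Group"
    "HOL-Computational_Algebra.Primes"
    "HOL-Library.Cardinality"
    "Jordan_Normal_Form.Determinant"
    "Jordan_Normal_Form.DL_Submatrix"
    "Jordan_Normal_Form.VS_Connect"
begin

section \<open>Trace and additive characters of a finite field\<close>

text \<open>The degree \<open>n\<close> of the field over its prime field, given by \<open>q = p ^ n\<close>.\<close>

definition field_degree :: "'a::finite_field itself \<Rightarrow> nat" where
  "field_degree _ = (THE n. CARD('a) = CHAR('a) ^ n)"

definition abs_trace :: "'a::finite_field \<Rightarrow> 'a" where
  "abs_trace x = (\<Sum>i<field_degree TYPE('a). x ^ (CHAR('a) ^ i))"

text \<open>
  \<^const>\<open>abs_trace\<close> takes its values in the prime field, a subset of the field itself, so the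
  exponential needs an integer representative; the choice is immaterial modulo \<open>p\<close>.
\<close>

definition abs_trace_rep :: "'a::finite_field \<Rightarrow> nat" where
  "abs_trace_rep x = (THE k. k < CHAR('a) \<and> of_nat k = abs_trace x)"

definition std_char :: "'a::finite_field \<Rightarrow> complex" where
  "std_char x = exp (2 * of_real pi * \<i> * of_nat (abs_trace_rep x) / of_nat CHAR('a))"

definition eps_char :: "'a::finite_field \<Rightarrow> 'a \<Rightarrow> complex" where
  "eps_char a x = std_char (a * x)"

definition additive_chars :: "('a::finite_field \<Rightarrow> complex) set" where
  "additive_chars = range eps_char"

section \<open>The group ring and the Fourier transform\<close>

text \<open>
  An element of the group ring of the additive group is its coefficient function;
  \<open>gr_basis b\<close> is the basis element \<open>[b]\<close>.
\<close>

definition gr_basis :: "'a \<Rightarrow> 'a \<Rightarrow> complex" where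
  "gr_basis b = (\<lambda>a. if a = b then 1 else 0)"

definition gr_supp :: "('a \<Rightarrow> complex) \<Rightarrow> 'a set" where
  "gr_supp f = {a. f a \<noteq> 0}"

definition char_extend :: "('a::finite_field \<Rightarrow> complex) \<Rightarrow> ('a \<Rightarrow> complex) \<Rightarrow> complex" where
  "char_extend \<psi> f = (\<Sum>a\<in>UNIV. f a * \<psi> a)"

text \<open>Meaningful only for arguments \<open>\<psi>\<close> in \<^const>\<open>additive_chars\<close>.\<close>

definition fourier :: "('a::finite_field \<Rightarrow> complex) \<Rightarrow> ('a \<Rightarrow> complex) \<Rightarrow> complex" where
  "fourier f \<psi> = char_extend \<psi> f"

definition fourier_supp :: "('a::finite_field \<Rightarrow> complex) \<Rightarrow> ('a \<Rightarrow> complex) set" where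
  "fourier_supp f = {\<psi> \<in> additive_chars. fourier f \<psi> \<noteq> 0}"

section \<open>Multiplicative subgroups, orbits and characters\<close>

text \<open>
  \<^term>\<open>class_ring\<close> is the ring record of a type class ring, so \<^term>\<open>mult_of class_ring\<close> is the
  group of all nonzero elements. A character of \<open>H\<close> is a total function of which only the values
  on \<open>H\<close> matter.
\<close>

definition mult_subgroup :: "'a::finite_field set \<Rightarrow> bool" where
  "mult_subgroup H \<longleftrightarrow> subgroup H (mult_of class_ring)"

definition mult_character :: "'a::finite_field set \<Rightarrow> ('a \<Rightarrow> complex) \<Rightarrow> bool" where
  "mult_character H \<chi> \<longleftrightarrow> \<chi> \<in> hom ((mult_of class_ring)\<lparr>carrier := H\<rparr>) (mult_of class_ring)"

definition trivial_character :: "'a::finite_field set \<Rightarrow> ('a \<Rightarrow> complex) \<Rightarrow> bool" where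
  "trivial_character H \<chi> \<longleftrightarrow> (\<forall>h\<in>H. \<chi> h = 1)"

definition mult_orbit :: "'a::finite_field set \<Rightarrow> 'a \<Rightarrow> 'a set" where
  "mult_orbit H a = (\<lambda>h. h * a) ` H"

definition orbit_representatives :: "'a::finite_field set \<Rightarrow> 'a set \<Rightarrow> 'a set \<Rightarrow> bool" where
  "orbit_representatives H X R \<longleftrightarrow> R \<subseteq> X \<and> (\<forall>orb \<in> mult_orbit H ` X. \<exists>!r. r \<in> R \<and> r \<in> orb)"

definition chi_symmetric ::
    "'a::finite_field set \<Rightarrow> ('a \<Rightarrow> complex) \<Rightarrow> ('a \<Rightarrow> complex) \<Rightarrow> bool" where
  "chi_symmetric H \<chi> f \<longleftrightarrow> (\<forall>h\<in>H. \<forall>a. f (h * a) = \<chi> h * f a)"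

section \<open>Strong uncertainty and compressed Fourier matrices\<close>

definition strong_uncertainty :: "'a::finite_field set \<Rightarrow> ('a \<Rightarrow> complex) \<Rightarrow> bool" where
  "strong_uncertainty H \<chi> \<longleftrightarrow>
     (\<forall>f. f \<noteq> (\<lambda>_. 0) \<and> chi_symmetric H \<chi> f \<longrightarrow>
        card (gr_supp f) + card (fourier_supp f) \<ge>
          (if \<not> trivial_character H \<chi> then CARD('a) + card H - 1
           else if f 0 = 0 \<and> fourier f (eps_char 0) = 0 then CARD('a) + 2 * card H - 1
           else if f 0 = 0 \<or> fourier f (eps_char 0) = 0 then CARD('a) + card H
           else CARD('a) + 1))"

definition u_elt :: "'a::finite_field set \<Rightarrow> ('a \<Rightarrow> complex) \<Rightarrow> 'a \<Rightarrow> 'a \<Rightarrow> complex" where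
  "u_elt H \<chi> r = (\<lambda>a. \<Sum>h\<in>H. \<chi> h * gr_basis (h * r) a)"

text \<open>The lists \<open>rs\<close> and \<open>ss\<close> are the chosen orderings of \<open>R\<close> and \<open>S\<close>.\<close>

definition compressed_fourier_matrix ::
    "'a::finite_field set \<Rightarrow> ('a \<Rightarrow> complex) \<Rightarrow> 'a set \<Rightarrow> 'a set \<Rightarrow> complex mat \<Rightarrow> bool" where
  "compressed_fourier_matrix H \<chi> R S M \<longleftrightarrow>
     (\<exists>rs ss. distinct rs \<and> set rs = R \<and> distinct ss \<and> set ss = S \<and>
        M = mat (length rs) (length ss)
              (\<lambda>(i, j). char_extend (eps_char (ss ! j)) (u_elt H \<chi> (rs ! i))))"

definition nonvanishing_minors :: "complex mat \<Rightarrow> bool" where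
  "nonvanishing_minors M \<longleftrightarrow> square_mat M \<and>
     (\<forall>I J. I \<subseteq> {..<dim_row M} \<and> J \<subseteq> {..<dim_col M} \<and> card I = card J \<and> card I \<ge> 1 \<longrightarrow>
        det (submatrix M I J) \<noteq> 0)"

end

theory Submission
  imports Defs "HOL-Algebra.Sylow" "HOL-Number_Theory.Cong"
begin

text \<open>
  A \<open>\<chi>\<close>-symmetric \<open>f\<close> is a combination \<open>f = \<Sum>r\<in>R. c r * u r\<close>, unique in \<open>c\<close>, and the values of its
  Fourier transform on \<open>S\<close> are the entries of the row vector \<open>c\<close> times \<open>M\<close>. Both supports are unions
  of \<open>H\<close>-orbits, so every case of the strong uncertainty property says that, for all \<open>c \<noteq> 0\<close>, the
  supports of \<open>c\<close> and of \<open>c\<close> times \<open>M\<close> together have more than \<open>|R|\<close> elements. A vector violating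
  this bound is the same thing as a left kernel vector of a square submatrix of \<open>M\<close>. Distinct
  elements of the field give distinct characters because the trace is not identically zero.
\<close>

section \<open>Minors and kernel vectors\<close>

text \<open>Lets sums over positions in a \<open>submatrix\<close>, which is indexed through
  \<open>pick\<close>, be rewritten as sums over the selected row and column indices.\<close>

lemma bij_betw_pick:
  assumes "finite I"
  shows "bij_betw (pick I) {..<card I} I"
proof -
  have inj: "inj_on (pick I) {..<card I}"
  proof (rule linorder_inj_onI')
    fix i j assume "i \<in> {..<card I}" "j \<in> {..<card I}" "i < j"
    then show "pick I i \<noteq> pick I j"
      using pick_mono_le[of j I i] by auto
  qed
  moreover have "pick I ` {..<card I} = I"
    using assms inj by (intro card_subset_eq) (auto simp: card_image pick_in_set_le)
  ultimately show ?thesis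
    by (simp add: bij_betw_def)
qed

text \<open>Singularity means a nonzero left kernel vector. It is given as a function
  \<open>c\<close> on the row indices of \<open>A\<close>, of which only the values on
  \<open>I\<close> count, so that no positions inside the submatrix appear.\<close>

lemma det_submatrix_eq_0_iff:
  fixes A :: "'a::field mat"
  assumes A: "A \<in> carrier_mat m n" and I: "I \<subseteq> {..<m}" and J: "J \<subseteq> {..<n}"
    and card: "card I = card J"
  shows "det (submatrix A I J) = 0 \<longleftrightarrow>
    (\<exists>c. (\<exists>i\<in>I. c i \<noteq> 0) \<and> (\<forall>j\<in>J. (\<Sum>i\<in>I. c i * A $$ (i, j)) = 0))"
proof -
  define k where "k = card I"
  \<comment> \<open>Transposing turns the left kernel vector into a column vector, as
    \<open>det_0_iff_vec_prod_zero\<close> expects.\<close>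
  define B where "B = transpose_mat (submatrix A I J)"
  have fin: "finite I" "finite J"
    using I J finite_subset by blast+
  have bI: "bij_betw (pick I) {..<k} I" and bJ: "bij_betw (pick J) {..<k} J"
    using bij_betw_pick[OF fin(1)] bij_betw_pick[OF fin(2)] card by (simp_all add: k_def)
  have eqs: "{i. i < m \<and> i \<in> I} = I" "{j. j < n \<and> j \<in> J} = J"
    using I J by auto
  have sub: "submatrix A I J \<in> carrier_mat k k"
    using A card by (auto simp: dim_submatrix eqs k_def)
  have B: "B \<in> carrier_mat k k"
    using sub by (simp add: B_def)
  have idx: "B $$ (j, i) = A $$ (pick I i, pick J j)" if "i < k" "j < k" for i j
  proof -
    have "submatrix A I J $$ (i, j) = A $$ (pick I i, pick J j)"
      using that A card by (intro submatrix_index) (auto simp: eqs k_def)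
    then show ?thesis
      using that sub by (simp add: B_def)
  qed
  have row: "(B *\<^sub>v vec k (\<lambda>i. c (pick I i))) $ j = (\<Sum>i\<in>I. c i * A $$ (i, pick J j))"
    if "j < k" for j and c
  proof -
    have "(B *\<^sub>v vec k (\<lambda>i. c (pick I i))) $ j = (\<Sum>i<k. B $$ (j, i) * c (pick I i))"
      using B that by (auto simp: scalar_prod_def atLeast0LessThan intro!: sum.cong)
    also have "\<dots> = (\<Sum>i<k. c (pick I i) * A $$ (pick I i, pick J j))"
      using that by (intro sum.cong) (auto simp: idx)
    also have "\<dots> = (\<Sum>i\<in>I. c i * A $$ (i, pick J j))"
      by (rule sum.reindex_bij_betw[OF bI])
    finally show ?thesis .
  qed
  have rows: "B *\<^sub>v vec k (\<lambda>i. c (pick I i)) = 0\<^sub>v k \<longleftrightarrow> (\<forall>j\<in>J. (\<Sum>i\<in>I. c i * A $$ (i, j)) = 0)"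
    for c
  proof -
    have "B *\<^sub>v vec k (\<lambda>i. c (pick I i)) = 0\<^sub>v k \<longleftrightarrow>
        (\<forall>j<k. (B *\<^sub>v vec k (\<lambda>i. c (pick I i))) $ j = 0)"
      using B by (auto simp: vec_eq_iff)
    also have "\<dots> \<longleftrightarrow> (\<forall>j<k. (\<Sum>i\<in>I. c i * A $$ (i, pick J j)) = 0)"
      using row by simp
    also have "\<dots> \<longleftrightarrow> (\<forall>j\<in>pick J ` {..<k}. (\<Sum>i\<in>I. c i * A $$ (i, j)) = 0)"
      by auto
    also have "pick J ` {..<k} = J"
      using bJ by (rule bij_betw_imp_surj_on)
    finally show ?thesis .
  qed
  have nz: "vec k (\<lambda>i. c (pick I i)) \<noteq> 0\<^sub>v k \<longleftrightarrow> (\<exists>i\<in>I. c i \<noteq> 0)" for c :: "nat \<Rightarrow> 'a"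
  proof -
    have "vec k (\<lambda>i. c (pick I i)) \<noteq> 0\<^sub>v k \<longleftrightarrow> (\<exists>i\<in>pick I ` {..<k}. c i \<noteq> 0)"
      by (auto simp: vec_eq_iff)
    then show ?thesis
      using bI by (simp add: bij_betw_imp_surj_on)
  qed
  have "det (submatrix A I J) = det B"
    using sub by (simp add: B_def det_transpose)
  then have "det (submatrix A I J) = 0 \<longleftrightarrow>
      (\<exists>v. v \<in> carrier_vec k \<and> v \<noteq> 0\<^sub>v k \<and> B *\<^sub>v v = 0\<^sub>v k)"
    using det_0_iff_vec_prod_zero[OF B] by simp
  also have "\<dots> \<longleftrightarrow> (\<exists>c. vec k (\<lambda>i. c (pick I i)) \<noteq> 0\<^sub>v k \<and> B *\<^sub>v vec k (\<lambda>i. c (pick I i)) = 0\<^sub>v k)"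
  proof
    assume "\<exists>v. v \<in> carrier_vec k \<and> v \<noteq> 0\<^sub>v k \<and> B *\<^sub>v v = 0\<^sub>v k"
    then obtain v where v: "v \<in> carrier_vec k" "v \<noteq> 0\<^sub>v k" "B *\<^sub>v v = 0\<^sub>v k"
      by blast
    have "v = vec k (\<lambda>i. v $ the_inv_into {..<k} (pick I) (pick I i))"
      using v(1) bI by (auto simp: vec_eq_iff bij_betw_def the_inv_into_f_f)
    with v show "\<exists>c. vec k (\<lambda>i. c (pick I i)) \<noteq> 0\<^sub>v k \<and> B *\<^sub>v vec k (\<lambda>i. c (pick I i)) = 0\<^sub>v k"
      by (intro exI[of _ "\<lambda>i. v $ the_inv_into {..<k} (pick I) i"]) simp
  next
    assume "\<exists>c. vec k (\<lambda>i. c (pick I i)) \<noteq> 0\<^sub>v k \<and> B *\<^sub>v vec k (\<lambda>i. c (pick I i)) = 0\<^sub>v k"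
    then obtain c where "vec k (\<lambda>i. c (pick I i)) \<noteq> 0\<^sub>v k" "B *\<^sub>v vec k (\<lambda>i. c (pick I i)) = 0\<^sub>v k"
      by blast
    then show "\<exists>v. v \<in> carrier_vec k \<and> v \<noteq> 0\<^sub>v k \<and> B *\<^sub>v v = 0\<^sub>v k"
      by (intro exI[of _ "vec k (\<lambda>i. c (pick I i))"]) simp
  qed
  finally show ?thesis
    by (simp only: rows nz)
qed

text \<open>If a combination of the rows in \<open>I\<close>, with all coefficients nonzero,
  vanishes in at least \<open>card I\<close> columns, then \<open>card I\<close> of these columns
  give a singular square submatrix. Conversely, a kernel vector of a singular submatrix of size
  \<open>k\<close>, extended by zero, has at most \<open>k\<close> nonzero coefficients and at most
  \<open>n - k\<close> nonzero column sums, one short of the bound.\<close>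

lemma nonvanishing_minors_iff_supports:
  assumes A: "A \<in> carrier_mat n n"
  shows "nonvanishing_minors A \<longleftrightarrow>
    (\<forall>c. (\<exists>i<n. c i \<noteq> 0) \<longrightarrow>
      n + 1 \<le> card {i. i < n \<and> c i \<noteq> 0} + card {j. j < n \<and> (\<Sum>i<n. c i * A $$ (i, j)) \<noteq> 0})"
    (is "_ \<longleftrightarrow> (\<forall>c. ?nz c \<longrightarrow> ?bound c)")
proof
  assume M: "nonvanishing_minors A"
  show "\<forall>c. ?nz c \<longrightarrow> ?bound c"
  proof (intro allI impI)
    fix c :: "nat \<Rightarrow> complex" assume nz: "\<exists>i<n. c i \<noteq> 0"
    define I where "I = {i. i < n \<and> c i \<noteq> 0}"
    define Z where "Z = {j. j < n \<and> (\<Sum>i<n. c i * A $$ (i, j)) = 0}"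
    have "{j. j < n \<and> (\<Sum>i<n. c i * A $$ (i, j)) \<noteq> 0} = {..<n} - Z"
      by (auto simp: Z_def)
    then have cardZ: "card {j. j < n \<and> (\<Sum>i<n. c i * A $$ (i, j)) \<noteq> 0} = n - card Z"
      by (simp add: card_Diff_subset Z_def subset_iff)
    have "card Z < card I"
    proof (rule ccontr)
      assume "\<not> card Z < card I"
      then obtain J where J: "J \<subseteq> Z" "card J = card I"
        by (metis not_less obtain_subset_with_card_n)
      have I_sub: "I \<subseteq> {..<n}" and J_sub: "J \<subseteq> {..<n}"
        using J by (auto simp: I_def Z_def)
      have "(\<Sum>i\<in>I. c i * A $$ (i, j)) = (\<Sum>i<n. c i * A $$ (i, j))" for j
        by (rule sum.mono_neutral_left) (auto simp: I_def)
      with J nz have "det (submatrix A I J) = 0"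
        by (subst det_submatrix_eq_0_iff[OF A I_sub J_sub])
          (auto simp: I_def Z_def intro!: exI[of _ c])
      moreover have "card I \<ge> 1"
        using nz by (auto simp: I_def Suc_le_eq card_gt_0_iff)
      ultimately show False
        using M A J(2) I_sub J_sub by (auto simp: nonvanishing_minors_def)
    qed
    moreover have "card Z \<le> n"
      using card_mono[of "{..<n}" Z] by (auto simp: Z_def)
    ultimately show "?bound c"
      unfolding cardZ I_def[symmetric] by linarith
  qed
next
  assume bound: "\<forall>c. ?nz c \<longrightarrow> ?bound c"
  show "nonvanishing_minors A"
    unfolding nonvanishing_minors_def
  proof (intro conjI allI impI notI; (elim conjE)?)
    show "square_mat A"
      using A by simp
    fix I J assume I: "I \<subseteq> {..<dim_row A}" and J: "J \<subseteq> {..<dim_col A}"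
      and IJ: "card I = card J" and "card I \<ge> 1" and "det (submatrix A I J) = 0"
    have I': "I \<subseteq> {..<n}" and J': "J \<subseteq> {..<n}"
      using A I J by auto
    obtain c where c: "\<exists>i\<in>I. c i \<noteq> 0" "\<forall>j\<in>J. (\<Sum>i\<in>I. c i * A $$ (i, j)) = 0"
      using \<open>det (submatrix A I J) = 0\<close> det_submatrix_eq_0_iff[OF A I' J' IJ] by blast
    define d where "d i = (if i \<in> I then c i else 0)" for i
    have d: "(\<Sum>i<n. d i * A $$ (i, j)) = (\<Sum>i\<in>I. c i * A $$ (i, j))" for j
      using I' by (intro sum.mono_neutral_cong_right) (auto simp: d_def)
    have "card {i. i < n \<and> d i \<noteq> 0} \<le> card I"
      using I' by (intro card_mono) (auto simp: d_def finite_subset split: if_splits)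
    moreover have "card {j. j < n \<and> (\<Sum>i<n. d i * A $$ (i, j)) \<noteq> 0} \<le> card ({..<n} - J)"
      using c(2) by (intro card_mono) (auto simp: d)
    moreover have "card ({..<n} - J) = n - card J" "card J \<le> n"
      using J' card_mono[OF _ J'] finite_subset[OF J'] by (auto simp: card_Diff_subset)
    ultimately have lt: "\<not> ?bound d"
      using IJ by linarith
    have "?nz d"
      using c(1) I' by (auto simp: d_def)
    with bound lt show False
      by blast
  qed
qed

lemma card_filter_nth:
  assumes "distinct xs"
  shows "card {x \<in> set xs. P x} = card {i. i < length xs \<and> P (xs ! i)}"
proof -
  have "{x \<in> set xs. P x} = (!) xs ` {i. i < length xs \<and> P (xs ! i)}"
    by (auto simp: in_set_conv_nth)
  moreover have "inj_on ((!) xs) {i. i < length xs \<and> P (xs ! i)}"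
    using assms by (intro inj_on_nth) auto
  ultimately show ?thesis
    by (simp add: card_image)
qed

text \<open>Replaces row and column positions by the list entries themselves, so that the orderings
  drop out of the criterion.\<close>

lemma nonvanishing_minors_iff_indexed_supports:
  assumes rs: "distinct rs" and ss: "distinct ss" and len: "length rs = length ss"
  shows "nonvanishing_minors (mat (length rs) (length ss) (\<lambda>(i, j). a (rs ! i) (ss ! j))) \<longleftrightarrow>
    (\<forall>c. (\<exists>r\<in>set rs. c r \<noteq> 0) \<longrightarrow>
      card (set rs) + 1 \<le> card {r \<in> set rs. c r \<noteq> 0}
        + card {s \<in> set ss. (\<Sum>r\<in>set rs. c r * a r s) \<noteq> 0})"
    (is "nonvanishing_minors ?A \<longleftrightarrow> (\<forall>c. ?P c)")
proof -
  define n where "n = length rs"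
  define Q where "Q d \<longleftrightarrow> (\<exists>i<n. d i \<noteq> 0) \<longrightarrow>
      n + 1 \<le> card {i. i < n \<and> d i \<noteq> 0} + card {j. j < n \<and> (\<Sum>i<n. d i * ?A $$ (i, j)) \<noteq> 0}"
    for d :: "nat \<Rightarrow> complex"
  have Q_cong: "Q d \<longleftrightarrow> Q e" if "\<And>i. i < n \<Longrightarrow> d i = e i" for d e
  proof -
    have "{i. i < n \<and> d i \<noteq> 0} = {i. i < n \<and> e i \<noteq> 0}" "(\<exists>i<n. d i \<noteq> 0) \<longleftrightarrow> (\<exists>i<n. e i \<noteq> 0)"
      using that by auto
    moreover have "(\<Sum>i<n. d i * x i) = (\<Sum>i<n. e i * x i)" for x
      using that by (intro sum.cong) auto
    ultimately show ?thesis
      by (simp add: Q_def)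
  qed
  have Q_P: "Q (\<lambda>i. c (rs ! i)) \<longleftrightarrow> ?P c" for c
  proof -
    have "(\<Sum>i<n. c (rs ! i) * ?A $$ (i, j)) = (\<Sum>r\<in>set rs. c r * a r (ss ! j))" if "j < n" for j
    proof -
      have "(\<Sum>i<n. c (rs ! i) * ?A $$ (i, j)) = (\<Sum>i<n. c (rs ! i) * a (rs ! i) (ss ! j))"
        using that len by (intro sum.cong) (auto simp: n_def)
      also have "\<dots> = (\<Sum>r\<in>set rs. c r * a r (ss ! j))"
        using rs by (intro sum.reindex_bij_betw bij_betw_nth) (auto simp: n_def)
      finally show ?thesis .
    qed
    then have "{j. j < n \<and> (\<Sum>i<n. c (rs ! i) * ?A $$ (i, j)) \<noteq> 0} =
        {j. j < length ss \<and> (\<Sum>r\<in>set rs. c r * a r (ss ! j)) \<noteq> 0}"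
      using len by (auto simp: n_def)
    moreover have "(\<exists>i<n. c (rs ! i) \<noteq> 0) \<longleftrightarrow> (\<exists>r\<in>set rs. c r \<noteq> 0)"
      by (simp add: n_def Bex_def in_set_conv_nth) metis
    ultimately show ?thesis
      using rs ss by (simp add: Q_def card_filter_nth n_def distinct_card)
  qed
  have "nonvanishing_minors ?A \<longleftrightarrow> (\<forall>d. Q d)"
    unfolding Q_def by (rule nonvanishing_minors_iff_supports) (use len in \<open>auto simp: n_def\<close>)
  also have "\<dots> \<longleftrightarrow> (\<forall>c. Q (\<lambda>i. c (rs ! i)))"
  proof (intro iffI allI)
    \<comment> \<open>Since \<open>rs\<close> has no repetitions, every \<open>d\<close> agrees
      below \<open>n\<close> with \<open>\<lambda>i. c (rs ! i)\<close> for a suitable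
      \<open>c\<close>, and \<open>Q\<close> looks only at arguments below \<open>n\<close>.\<close>
    fix d assume "\<forall>c. Q (\<lambda>i. c (rs ! i))"
    then have "Q (\<lambda>i. d (the_inv_into {..<n} ((!) rs) (rs ! i)))"
      by (rule allE[where x = "\<lambda>r. d (the_inv_into {..<n} ((!) rs) r)"])
    moreover have "the_inv_into {..<n} ((!) rs) (rs ! i) = i" if "i < n" for i
      using that rs by (intro the_inv_into_f_f inj_on_nth) (auto simp: n_def)
    ultimately show "Q d"
      using Q_cong[of "\<lambda>i. d (the_inv_into {..<n} ((!) rs) (rs ! i))" d] by simp
  qed auto
  finally show ?thesis
    by (simp only: Q_P)
qed

section \<open>The trace and the additive characters\<close>

text \<open>Sylow's theorem yields an additive subgroup of order \<open>r\<close>, hence some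
  \<open>x \<noteq> 0\<close> with \<open>of_nat r * x = 0\<close>. As \<open>x\<close> is
  invertible, \<open>r\<close> vanishes in the field, so the characteristic divides the prime
  \<open>r\<close>.\<close>

lemma prime_dvd_card_imp_eq_CHAR:
  assumes r: "prime r" "r dvd CARD('a::finite_field)"
  shows "r = CHAR('a)"
proof -
  define G :: "'a monoid" where "G = \<lparr>carrier = (UNIV :: 'a set), monoid.mult = (+), one = 0\<rparr>"
  interpret group G
  proof (rule groupI)
    fix x assume "x \<in> carrier G"
    show "\<exists>y\<in>carrier G. y \<otimes>\<^bsub>G\<^esub> x = \<one>\<^bsub>G\<^esub>"
      by (intro bexI[of _ "-x"]) (auto simp: G_def)
  qed (auto simp: G_def add_ac)
  have pow: "x [^]\<^bsub>G\<^esub> n = of_nat n * x" for x and n :: nat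
    by (induction n) (auto simp: G_def nat_pow_def algebra_simps)
  obtain m where "CARD('a) = r * m"
    using r(2) by (elim dvdE)
  then have "Coset.order G = r ^ 1 * m" and "finite (carrier G)"
    by (simp_all add: Coset.order_def G_def)
  then obtain K where K: "subgroup K G" "card K = r ^ 1"
    using sylow_thm[OF r(1) is_group] by blast
  have "card K > 1"
    using K(2) prime_gt_1_nat[OF r(1)] by simp
  then have "\<not> K \<subseteq> {0}"
    using card_mono[of "{0}" K] by auto
  then obtain x where x: "x \<in> K" "x \<noteq> 0"
    by blast
  interpret K: group "G\<lparr>carrier := K\<rparr>"
    using K(1) by (rule subgroup_imp_group)
  have "x [^]\<^bsub>G\<lparr>carrier := K\<rparr>\<^esub> r = \<one>\<^bsub>G\<lparr>carrier := K\<rparr>\<^esub>"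
    using K.pow_order_eq_1[of x] x K(2) by (simp add: Coset.order_def)
  then have "x [^]\<^bsub>G\<^esub> r = \<one>\<^bsub>G\<^esub>"
    unfolding nat_pow_consistent[of x r K, symmetric] by simp
  then have "of_nat r * x = 0"
    unfolding pow by (simp add: G_def)
  then have "CHAR('a) dvd r"
    using x(2) by (simp add: of_nat_eq_0_iff_char_dvd)
  then show ?thesis
    using r(1) by (metis CHAR_prime primes_dvd_imp_eq)
qed

text \<open>Once all factors \<open>CHAR('a)\<close> are split off, no prime can divide the
  cofactor.\<close>

lemma card_finite_field: "\<exists>n. CARD('a::finite_field) = CHAR('a) ^ n"
proof -
  obtain y where y: "CARD('a) = CHAR('a) ^ multiplicity CHAR('a) CARD('a) * y" "\<not> CHAR('a) dvd y"
    using multiplicity_decompose'[of "CARD('a)" "CHAR('a)"]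
    by (metis CHAR_prime zero_less_card_finite less_irrefl not_prime_unit)
  have "y = 1"
  proof (rule ccontr)
    assume "y \<noteq> 1"
    then obtain r where r: "prime r" "r dvd y"
      using prime_factor_nat by blast
    then have "r dvd CARD('a)"
      using y(1) by (metis dvd_mult)
    with r y(2) show False
      using prime_dvd_card_imp_eq_CHAR by blast
  qed
  with y(1) show ?thesis
    by auto
qed

text \<open>Existence and uniqueness of the exponent make the definite description in
  \<open>field_degree\<close> meaningful.\<close>

lemma CHAR_power_field_degree: "CHAR('a::finite_field) ^ field_degree TYPE('a) = CARD('a)"
proof -
  have "CHAR('a) > 1"
    using CHAR_prime prime_gt_1_nat by blast
  then have "\<exists>!n. CARD('a) = CHAR('a) ^ n"
    using card_finite_field[where 'a = 'a] by (metis power_inject_exp)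
  from theI'[OF this] show ?thesis
    by (simp add: field_degree_def)
qed

lemma field_degree_pos: "field_degree TYPE('a::finite_field) > 0"
proof (rule ccontr)
  assume "\<not> field_degree TYPE('a) > 0"
  then have "CARD('a) = 1"
    using CHAR_power_field_degree[where 'a = 'a] by simp
  then have "(0::'a) = 1"
    by (metis UNIV_I card_1_singletonE singletonD)
  then show False
    by simp
qed

section \<open>The absolute trace and the prime field\<close>

lemma abs_trace_diff: "abs_trace (x - y) = abs_trace x - abs_trace (y::'a::finite_field)"
proof -
  have "abs_trace (u + v) = abs_trace u + abs_trace v" for u v :: 'a
    by (simp add: abs_trace_def freshmans_dream' sum.distrib)
  from this[of "x - y" y] show ?thesis
    by simp
qed

text \<open>Frobenius permutes the summands \<open>x ^ (p ^ i)\<close> of the trace cyclically,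
  since \<open>x ^ (p ^ n) = x\<close>.\<close>

lemma abs_trace_power_CHAR: "abs_trace x ^ CHAR('a) = abs_trace (x::'a::finite_field)"
proof -
  define n where "n = field_degree TYPE('a)"
  have "abs_trace x ^ CHAR('a) = (\<Sum>i<n. x ^ (CHAR('a) ^ Suc i))"
    by (simp add: abs_trace_def freshmans_dream_sum n_def power_mult[symmetric] mult.commute)
  \<comment> \<open>Adding \<open>x\<close> restores the term at \<open>i = 0\<close>; the sum of
    \<open>n + 1\<close> terms is then split at its last term instead.\<close>
  also have "\<dots> + x = (\<Sum>i<Suc n. x ^ (CHAR('a) ^ i))"
    by (subst sum.lessThan_Suc_shift) simp
  also have "\<dots> = abs_trace x + x"
    by (simp add: abs_trace_def n_def CHAR_power_field_degree finite_field_power_card_eq_same)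
  finally show ?thesis
    by simp
qed

text \<open>The polynomial \<open>X ^ p - X\<close> has at most \<open>p\<close> roots, and the
  \<open>p\<close> elements of the prime field already are roots of it.\<close>

lemma power_CHAR_fixed_imp_of_nat:
  fixes y :: "'a::finite_field"
  assumes "y ^ CHAR('a) = y"
  shows "\<exists>k<CHAR('a). of_nat k = y"
proof -
  define p where "p = CHAR('a)"
  have p: "p > 1" "prime p"
    unfolding p_def using CHAR_prime prime_gt_1_nat by blast+
  define P :: "'a poly" where "P = monom 1 p - monom 1 1"
  have "coeff P p = 1"
    using p by (simp add: P_def)
  then have "P \<noteq> 0"
    by auto
  moreover have "degree P \<le> p"
    unfolding P_def using p
    by (intro degree_diff_le order_trans[OF degree_monom_le]) auto
  ultimately have le: "card {x. poly P x = 0} \<le> p"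
    using card_poly_roots_bound[of P] by linarith
  have P: "poly P x = 0 \<longleftrightarrow> x ^ p = x" for x
    by (simp add: P_def poly_monom)
  \<comment> \<open>Fermat's little theorem, by induction from the additivity of the Frobenius
    map.\<close>
  have "(of_nat k :: 'a) ^ p = of_nat k" for k
    using p by (induction k) (auto simp: freshmans_dream p_def)
  then have sub: "of_nat ` {..<p} \<subseteq> {x. poly P x = 0}"
    by (auto simp: P)
  have "inj_on (of_nat :: nat \<Rightarrow> 'a) {..<p}"
    by (auto simp: inj_on_def of_nat_eq_iff_cong_CHAR cong_def p_def)
  then have "card (of_nat ` {..<p} :: 'a set) = p"
    by (simp add: card_image)
  with sub le have "of_nat ` {..<p} = {x. poly P x = 0}"
    by (intro card_seteq) auto
  moreover have "poly P y = 0"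
    using assms by (simp add: P p_def)
  ultimately have "y \<in> of_nat ` {..<p}"
    by blast
  then show ?thesis
    by (auto simp: p_def)
qed

text \<open>The trace is fixed by Frobenius, so it lies in the prime field; this makes the definite
  description in \<open>abs_trace_rep\<close> meaningful.\<close>

lemma abs_trace_rep:
  fixes x :: "'a::finite_field"
  shows "abs_trace_rep x < CHAR('a)" and "of_nat (abs_trace_rep x) = abs_trace x"
proof -
  have "\<exists>!k. k < CHAR('a) \<and> of_nat k = abs_trace x"
  proof (rule ex_ex1I)
    show "\<exists>k. k < CHAR('a) \<and> of_nat k = abs_trace x"
      using power_CHAR_fixed_imp_of_nat[OF abs_trace_power_CHAR[of x]] by blast
    fix k l assume "k < CHAR('a) \<and> of_nat k = abs_trace x" "l < CHAR('a) \<and> of_nat l = abs_trace x"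
    then have "k < CHAR('a)" "l < CHAR('a)" "(of_nat k :: 'a) = of_nat l"
      by auto
    then show "k = l"
      by (simp add: of_nat_eq_iff_cong_CHAR cong_def)
  qed
  from theI'[OF this] show "abs_trace_rep x < CHAR('a)" "of_nat (abs_trace_rep x) = abs_trace x"
    by (simp_all add: abs_trace_rep_def)
qed

text \<open>As a polynomial function of degree \<open>p ^ (n - 1) < p ^ n\<close>, the trace cannot vanish everywhere.\<close>

lemma abs_trace_nonzero: "\<exists>x::'a::finite_field. abs_trace x \<noteq> 0"
proof (rule ccontr)
  assume "\<not> ?thesis"
  then have zero: "abs_trace x = 0" for x :: 'a
    by blast
  define p where "p = CHAR('a)"
  have p: "p > 1"
    unfolding p_def using CHAR_prime prime_gt_1_nat by blast
  obtain m where m: "field_degree TYPE('a) = Suc m"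
    using field_degree_pos[where 'a = 'a] gr0_implies_Suc by blast
  define P :: "'a poly" where "P = (\<Sum>i<Suc m. monom 1 (p ^ i))"
  have "coeff P (p ^ m) = (\<Sum>i<Suc m. if i = m then 1 else 0)"
    unfolding P_def coeff_sum using p by (intro sum.cong) auto
  then have "P \<noteq> 0"
    by auto
  have "degree P \<le> p ^ m"
    unfolding P_def using p
    by (intro degree_sum_le order_trans[OF degree_monom_le] power_increasing) auto
  moreover have "poly P x = abs_trace x" for x
    by (simp add: P_def abs_trace_def m poly_sum poly_monom p_def)
  ultimately have "CARD('a) \<le> p ^ m"
    using card_poly_roots_bound[OF \<open>P \<noteq> 0\<close>] zero by simp
  moreover have "CARD('a) = p ^ Suc m"
    using CHAR_power_field_degree[where 'a = 'a] by (simp add: m p_def)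
  ultimately show False
    using p by simp
qed

section \<open>Separation of additive characters\<close>

text \<open>The representatives lie below \<open>p\<close>, and \<open>cis (2 * pi * k / p)\<close>
  is injective on such \<open>k\<close>. In the other direction, \<open>abs_trace_rep x\<close>
  depends on \<open>x\<close> only through its trace.\<close>

lemma std_char_eq_iff: "std_char x = std_char y \<longleftrightarrow> abs_trace x = abs_trace (y::'a::finite_field)"
proof
  have cis: "std_char z = cis (2 * pi * real (abs_trace_rep z) / real CHAR('a))" for z :: 'a
    by (simp add: std_char_def cis_conv_exp mult_ac)
  assume eq: "std_char x = std_char y"
  have inj: "inj_on (\<lambda>k. cis (2 * pi * real k / real CHAR('a))) {..<CHAR('a)}"
    using bij_betw_roots_unity[of "CHAR('a)"] by (simp add: bij_betw_def)
  have "abs_trace_rep x = abs_trace_rep y"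
    using inj_onD[OF inj eq[unfolded cis]] abs_trace_rep(1)[of x] abs_trace_rep(1)[of y] by simp
  then show "abs_trace x = abs_trace y"
    by (metis abs_trace_rep(2))
next
  assume "abs_trace x = abs_trace y"
  then show "std_char x = std_char y"
    by (simp add: std_char_def abs_trace_rep_def)
qed

lemma inj_eps_char: "inj (eps_char :: 'a::finite_field \<Rightarrow> _)"
proof (rule injI, rule ccontr)
  fix a b :: 'a assume eq: "eps_char a = eps_char b" and "a \<noteq> b"
  obtain x :: 'a where x: "abs_trace x \<noteq> 0"
    using abs_trace_nonzero by blast
  \<comment> \<open>At the point \<open>x / (a - b)\<close> the arguments of the two characters
    differ by exactly \<open>x\<close>, whose trace is nonzero.\<close>
  have "abs_trace (a * (x / (a - b))) = abs_trace (b * (x / (a - b)))"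
    using fun_cong[OF eq, of "x / (a - b)"] unfolding eps_char_def std_char_eq_iff .
  then have "abs_trace (a * (x / (a - b)) - b * (x / (a - b))) = 0"
    by (simp add: abs_trace_diff)
  moreover have "a * (x / (a - b)) - b * (x / (a - b)) = x"
    using \<open>a \<noteq> b\<close> by (simp only: left_diff_distrib[symmetric]) simp
  ultimately show False
    using x by simp
qed

text \<open>By injectivity, characters can be counted through their indices in the field, on which
  \<open>H\<close> acts.\<close>

lemma card_fourier_supp:
  fixes f :: "'a::finite_field \<Rightarrow> complex"
  shows "card (fourier_supp f) = card {a. fourier f (eps_char a) \<noteq> 0}"
proof -
  have "fourier_supp f = eps_char ` {a. fourier f (eps_char a) \<noteq> 0}"
    by (auto simp: fourier_supp_def additive_chars_def)
  then show ?thesis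
    using inj_eps_char by (metis card_image inj_on_subset subset_UNIV)
qed

section \<open>Symmetric functions and orbits\<close>

locale multiplicative_character =
  fixes H :: "'a::finite_field set" and \<chi> :: "'a \<Rightarrow> complex"
  assumes subgroup_H: "mult_subgroup H" and character_\<chi>: "mult_character H \<chi>"
begin

lemma H_mult: "h \<in> H \<Longrightarrow> k \<in> H \<Longrightarrow> h * k \<in> H"
  using subgroup.m_closed[OF subgroup_H[unfolded mult_subgroup_def]] by simp

lemma H_one: "1 \<in> H"
  using subgroup.one_closed[OF subgroup_H[unfolded mult_subgroup_def]] by simp

lemma H_nonzero: "h \<in> H \<Longrightarrow> h \<noteq> 0"
  using subgroup.subset[OF subgroup_H[unfolded mult_subgroup_def]] by auto

lemma H_inverse:
  assumes h: "h \<in> H"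
  shows "inverse h \<in> H"
proof -
  have mon: "monoid (mult_of (class_ring :: 'a ring))"
    by unfold_locales auto
  have "inv\<^bsub>mult_of class_ring\<^esub> h = inverse h"
    by (rule monoid.inv_char[OF mon]) (use H_nonzero[OF h] in auto)
  then show ?thesis
    using subgroup.m_inv_closed[OF subgroup_H[unfolded mult_subgroup_def] h] by simp
qed

lemma card_H_pos: "card H > 0"
  using H_one by (auto simp: card_gt_0_iff)

lemma \<chi>_mult: "h \<in> H \<Longrightarrow> k \<in> H \<Longrightarrow> \<chi> (h * k) = \<chi> h * \<chi> k"
  using character_\<chi> by (auto simp: mult_character_def hom_def)

lemma \<chi>_nonzero: "h \<in> H \<Longrightarrow> \<chi> h \<noteq> 0"
  using character_\<chi> by (auto simp: mult_character_def hom_def)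

lemma \<chi>_one: "\<chi> 1 = 1"
  using \<chi>_mult[OF H_one H_one] \<chi>_nonzero[OF H_one] by simp

lemma bij_betw_mult_H: "h \<in> H \<Longrightarrow> bij_betw ((*) h) H H"
  by (rule bij_betwI[of _ _ _ "(*) (inverse h)"]) (auto simp: H_mult H_inverse H_nonzero)

lemma bij_betw_mult_UNIV: "h \<in> H \<Longrightarrow> bij_betw ((*) h) UNIV UNIV"
  by (rule bij_betwI[of _ _ _ "(*) (inverse h)"]) (auto simp: H_nonzero)

section \<open>Orbit representatives and counting by orbits\<close>

text \<open>The union of the orbits that can carry a \<open>\<chi>\<close>-symmetric function: for
  nontrivial \<open>\<chi>\<close> such a function vanishes at \<open>0\<close>.\<close>

definition orbit_domain :: "'a set" where
  "orbit_domain = (if trivial_character H \<chi> then UNIV else UNIV - {0})"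

lemma representative_exists:
  assumes R: "orbit_representatives H orbit_domain R" and a: "a \<in> orbit_domain"
  obtains h r where "h \<in> H" "r \<in> R" "a = h * r"
proof -
  obtain r where r: "r \<in> R" "r \<in> mult_orbit H a"
    using R a unfolding orbit_representatives_def by blast
  then obtain h where h: "h \<in> H" "r = h * a"
    by (auto simp: mult_orbit_def)
  then show ?thesis
    using that[OF H_inverse[OF h(1)] r(1)] H_nonzero by simp
qed

lemma representative_unique:
  assumes R: "orbit_representatives H orbit_domain R"
    and r: "r \<in> R" "r' \<in> R" and h: "h \<in> H" "r' = h * r"
  shows "r' = r"
proof -
  have "r \<in> orbit_domain"
    using R r(1) by (auto simp: orbit_representatives_def)
  then have "\<exists>!s. s \<in> R \<and> s \<in> mult_orbit H r"
    using R by (auto simp: orbit_representatives_def)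
  moreover have "r \<in> mult_orbit H r" "r' \<in> mult_orbit H r"
    using h H_one by (auto simp: mult_orbit_def intro: image_eqI[of _ _ 1])
  ultimately show ?thesis
    using r by blast
qed

lemma zero_in_representatives_iff:
  assumes R: "orbit_representatives H orbit_domain R"
  shows "0 \<in> R \<longleftrightarrow> trivial_character H \<chi>"
proof
  assume "0 \<in> R"
  then have "0 \<in> orbit_domain"
    using R by (auto simp: orbit_representatives_def)
  then show "trivial_character H \<chi>"
    by (auto simp: orbit_domain_def split: if_splits)
next
  assume "trivial_character H \<chi>"
  then have "0 \<in> orbit_domain"
    by (simp add: orbit_domain_def)
  then obtain h r where "h \<in> H" "r \<in> R" "0 = h * r"
    using representative_exists[OF R] by blast
  then show "0 \<in> R"
    using H_nonzero by force
qed

text \<open>\<open>H\<close> acts freely on the nonzero elements, so each is \<open>h * r\<close>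
  for exactly one pair of \<open>h\<close> in \<open>H\<close> and a representative
  \<open>r\<close>. The element \<open>0\<close> has an orbit of size one and is counted
  separately.\<close>

lemma card_invariant_nonzero:
  assumes R: "orbit_representatives H orbit_domain R"
    and inv: "\<And>h a. h \<in> H \<Longrightarrow> P (h * a) \<longleftrightarrow> P a"
  shows "card {a. a \<noteq> 0 \<and> P a} = card H * card {r \<in> R. r \<noteq> 0 \<and> P r}"
proof -
  have "bij_betw (\<lambda>(h, r). h * r) (H \<times> {r \<in> R. r \<noteq> 0 \<and> P r}) {a. a \<noteq> 0 \<and> P a}"
    unfolding bij_betw_def
  proof
    show "inj_on (\<lambda>(h, r). h * r) (H \<times> {r \<in> R. r \<noteq> 0 \<and> P r})"
    proof (rule inj_onI, clarsimp)
      fix h r k s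
      assume h: "h \<in> H" "k \<in> H" and r: "r \<in> R" "s \<in> R" "r \<noteq> 0" and eq: "h * r = k * s"
      have "s = (inverse k * h) * r"
        using eq H_nonzero[OF h(2)] by (simp add: field_simps)
      then have "s = r"
        using representative_unique[OF R r(1,2)] h H_mult H_inverse by blast
      with eq r(3) show "h = k \<and> r = s"
        by simp
    qed
    show "(\<lambda>(h, r). h * r) ` (H \<times> {r \<in> R. r \<noteq> 0 \<and> P r}) = {a. a \<noteq> 0 \<and> P a}"
    proof (intro equalityI subsetI)
      fix a assume a: "a \<in> {a. a \<noteq> 0 \<and> P a}"
      then have "a \<in> orbit_domain"
        by (simp add: orbit_domain_def)
      then obtain h r where hr: "h \<in> H" "r \<in> R" "a = h * r"
        by (rule representative_exists[OF R])
      with a inv have "(h, r) \<in> H \<times> {r \<in> R. r \<noteq> 0 \<and> P r}"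
        by auto
      with hr(3) show "a \<in> (\<lambda>(h, r). h * r) ` (H \<times> {r \<in> R. r \<noteq> 0 \<and> P r})"
        by force
    qed (auto simp: inv H_nonzero)
  qed
  from bij_betw_same_card[OF this] show ?thesis
    by (simp add: card_cartesian_product)
qed

lemma card_field_eq:
  assumes "orbit_representatives H orbit_domain R"
  shows "CARD('a) = card H * card (R - {0}) + 1"
proof -
  have "card {a::'a. a \<noteq> 0} = card H * card (R - {0})"
    using card_invariant_nonzero[OF assms, of "\<lambda>_. True"] by (simp add: set_diff_eq)
  moreover have "card {a::'a. a \<noteq> 0} = CARD('a) - 1"
    using card_Diff_singleton[of "0::'a" UNIV] by (simp add: set_diff_eq)
  moreover have "CARD('a) > 0"
    by simp
  ultimately show ?thesis
    by linarith
qed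

lemma card_representatives:
  assumes R: "orbit_representatives H orbit_domain R"
  shows "card R = card (R - {0}) + (if trivial_character H \<chi> then 1 else 0)"
proof (cases "trivial_character H \<chi>")
  case True
  then have "0 \<in> R"
    using zero_in_representatives_iff[OF R] by simp
  then show ?thesis
    using True card_Suc_Diff1[of R 0] by simp
next
  case False
  then show ?thesis
    using zero_in_representatives_iff[OF R] by simp
qed

text \<open>Both sets contain one element from each of the \<open>(q - 1) / card H\<close> nonzero
  orbits, and \<open>0\<close> under the same condition. This is what makes the compressed Fourier
  matrix square.\<close>

lemma card_representatives_eq:
  assumes R: "orbit_representatives H orbit_domain R" and S: "orbit_representatives H orbit_domain S"
  shows "card R = card S"
proof -
  have "card (R - {0}) = card (S - {0})"
    using card_field_eq[OF R] card_field_eq[OF S] nat_mult_eq_cancel1[OF card_H_pos] by simp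
  then show ?thesis
    using card_representatives[OF R] card_representatives[OF S] by simp
qed

text \<open>The witness \<open>k\<close> is the number of nonzero orbits in the support of
  \<open>g\<close>. Only invariance of the support is assumed, so that the lemma applies both to
  \<open>f\<close> and to its Fourier transform, which transforms by the inverse of
  \<open>\<chi>\<close>.\<close>

lemma card_support:
  assumes R: "orbit_representatives H orbit_domain R"
    and inv: "\<And>h a. h \<in> H \<Longrightarrow> g (h * a) \<noteq> 0 \<longleftrightarrow> g a \<noteq> (0::complex)"
    and zero: "\<not> trivial_character H \<chi> \<Longrightarrow> g 0 = 0"
  shows "\<exists>k. card {r \<in> R. g r \<noteq> 0} = k + (if g 0 = 0 then 0 else 1) \<and>
    card {a. g a \<noteq> 0} = card H * k + (if g 0 = 0 then 0 else 1)"
proof (intro exI conjI)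
  let ?k = "card {r \<in> R. r \<noteq> 0 \<and> g r \<noteq> 0}"
  have split: "card {a \<in> A. g a \<noteq> 0} = card {a \<in> A. a \<noteq> 0 \<and> g a \<noteq> 0} + (if g 0 = 0 then 0 else 1)"
    if "g 0 = 0 \<or> 0 \<in> A" for A
  proof (cases "g 0 = 0")
    case True
    then have "{a \<in> A. g a \<noteq> 0} = {a \<in> A. a \<noteq> 0 \<and> g a \<noteq> 0}"
      by auto
    with True show ?thesis
      by simp
  next
    case False
    then have "{a \<in> A. g a \<noteq> 0} = insert 0 {a \<in> A. a \<noteq> 0 \<and> g a \<noteq> 0}"
      using that by auto
    with False show ?thesis
      by simp
  qed
  show "card {r \<in> R. g r \<noteq> 0} = ?k + (if g 0 = 0 then 0 else 1)"
    by (rule split) (use zero zero_in_representatives_iff[OF R] in blast)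
  show "card {a. g a \<noteq> 0} = card H * ?k + (if g 0 = 0 then 0 else 1)"
    using split[of UNIV] card_invariant_nonzero[OF R, of "\<lambda>a. g a \<noteq> 0"] inv by simp
qed

section \<open>Fourier transforms of symmetric functions\<close>

lemma chi_symmetric_zero:
  assumes "chi_symmetric H \<chi> f" "\<not> trivial_character H \<chi>"
  shows "f 0 = 0"
proof -
  obtain h where "h \<in> H" "\<chi> h \<noteq> 1"
    using assms(2) by (auto simp: trivial_character_def)
  moreover from this have "f (h * 0) = \<chi> h * f 0"
    using assms(1) unfolding chi_symmetric_def by blast
  ultimately show ?thesis
    by simp
qed

lemma chi_symmetric_eqI:
  assumes R: "orbit_representatives H orbit_domain R"
    and f: "chi_symmetric H \<chi> f" and g: "chi_symmetric H \<chi> g"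
    and eq: "\<And>r. r \<in> R \<Longrightarrow> f r = g r"
  shows "f = g"
proof
  fix a
  show "f a = g a"
  proof (cases "a \<in> orbit_domain")
    case True
    then obtain h r where "h \<in> H" "r \<in> R" "a = h * r"
      by (rule representative_exists[OF R])
    then show ?thesis
      using f g eq by (simp add: chi_symmetric_def)
  next
    case False
    then have "a = 0" "\<not> trivial_character H \<chi>"
      by (auto simp: orbit_domain_def split: if_splits)
    then show ?thesis
      using chi_symmetric_zero[OF f] chi_symmetric_zero[OF g] by simp
  qed
qed

text \<open>Substituting \<open>h * a\<close> for \<open>a\<close> in the defining sum moves
  \<open>h\<close> into the index of the character. The transform is thus symmetric for the inverse
  character of \<open>\<chi>\<close>.\<close>

lemma fourier_mult:
  assumes f: "chi_symmetric H \<chi> f" and h: "h \<in> H"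
  shows "\<chi> h * fourier f (eps_char (h * s)) = fourier f (eps_char s)"
proof -
  have "fourier f (eps_char s) = (\<Sum>a\<in>UNIV. f (h * a) * eps_char s (h * a))"
    unfolding fourier_def char_extend_def
    by (rule sum.reindex_bij_betw[OF bij_betw_mult_UNIV[OF h], symmetric])
  also have "\<dots> = (\<Sum>a\<in>UNIV. \<chi> h * (f a * eps_char (h * s) a))"
    using f h by (intro sum.cong) (auto simp: chi_symmetric_def eps_char_def mult_ac)
  finally show ?thesis
    by (simp add: fourier_def char_extend_def sum_distrib_left)
qed

lemma fourier_zero:
  assumes "chi_symmetric H \<chi> f" "\<not> trivial_character H \<chi>"
  shows "fourier f (eps_char 0) = 0"
proof -
  obtain h where "h \<in> H" "\<chi> h \<noteq> 1"
    using assms(2) by (auto simp: trivial_character_def)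
  with fourier_mult[OF assms(1), of h 0] show ?thesis
    by simp
qed

section \<open>A basis of the symmetric functions\<close>

lemma u_elt_symmetric: "chi_symmetric H \<chi> (u_elt H \<chi> r)"
  unfolding chi_symmetric_def
proof (intro ballI allI)
  fix h a assume h: "h \<in> H"
  have "u_elt H \<chi> r (h * a) = (\<Sum>k\<in>H. \<chi> (h * k) * gr_basis (h * k * r) (h * a))"
    unfolding u_elt_def by (rule sum.reindex_bij_betw[OF bij_betw_mult_H[OF h], symmetric])
  also have "\<dots> = (\<Sum>k\<in>H. \<chi> h * (\<chi> k * gr_basis (k * r) a))"
    using h H_nonzero[OF h] by (intro sum.cong) (auto simp: \<chi>_mult gr_basis_def mult_ac)
  finally show "u_elt H \<chi> r (h * a) = \<chi> h * u_elt H \<chi> r a"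
    by (simp add: u_elt_def sum_distrib_left)
qed

lemma u_elt_other_representative:
  assumes "orbit_representatives H orbit_domain R" "r \<in> R" "s \<in> R" "r \<noteq> s"
  shows "u_elt H \<chi> r s = 0"
  unfolding u_elt_def gr_basis_def
  using assms representative_unique by (intro sum.neutral) fastforce

text \<open>For \<open>r \<noteq> 0\<close> only \<open>h = 1\<close> contributes, giving
  \<open>1\<close>. For \<open>r = 0\<close> every \<open>h\<close> contributes, but then
  \<open>\<chi>\<close> is trivial and the value is \<open>card H\<close>.\<close>

lemma u_elt_self_nonzero:
  assumes R: "orbit_representatives H orbit_domain R" and r: "r \<in> R"
  shows "u_elt H \<chi> r r \<noteq> 0"
proof (cases "r = 0")
  case True
  then have "\<And>h. h \<in> H \<Longrightarrow> \<chi> h = 1"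
    using zero_in_representatives_iff[OF R] r by (simp add: trivial_character_def)
  then have "u_elt H \<chi> r r = of_nat (card H)"
    using True by (simp add: u_elt_def gr_basis_def)
  then show ?thesis
    using H_one by auto
next
  case False
  then have "u_elt H \<chi> r r = (\<Sum>h\<in>H. if h = 1 then \<chi> h else 0)"
    unfolding u_elt_def gr_basis_def by (intro sum.cong) auto
  then show ?thesis
    using H_one \<chi>_one by (simp add: sum.delta)
qed

definition synthesis :: "'a set \<Rightarrow> ('a \<Rightarrow> complex) \<Rightarrow> 'a \<Rightarrow> complex" where
  "synthesis R c = (\<lambda>a. \<Sum>r\<in>R. c r * u_elt H \<chi> r a)"

lemma synthesis_symmetric: "chi_symmetric H \<chi> (synthesis R c)"
  using u_elt_symmetric
  by (simp add: chi_symmetric_def synthesis_def sum_distrib_left mult.left_commute)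

lemma synthesis_representative:
  assumes R: "orbit_representatives H orbit_domain R" and r: "r \<in> R"
  shows "synthesis R c r = c r * u_elt H \<chi> r r"
proof -
  have "synthesis R c r = (\<Sum>s\<in>R. if s = r then c r * u_elt H \<chi> r r else 0)"
    unfolding synthesis_def using u_elt_other_representative[OF R _ r] by (intro sum.cong) auto
  then show ?thesis
    using r by (simp add: sum.delta)
qed

text \<open>Linearity; at \<open>\<psi> = eps_char s\<close> the right-hand side is the entry at
  \<open>s\<close> of the row vector \<open>c\<close> times the compressed Fourier matrix.\<close>

lemma fourier_synthesis:
  "fourier (synthesis R c) \<psi> = (\<Sum>r\<in>R. c r * char_extend \<psi> (u_elt H \<chi> r))"
  unfolding fourier_def char_extend_def synthesis_def sum_distrib_left sum_distrib_right
  by (subst sum.swap) (simp add: mult_ac)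

text \<open>Symmetric functions are determined on \<open>R\<close>, where
  \<open>u_elt H \<chi> r\<close> is nonzero only at \<open>r\<close>. The division is there because
  this value is \<open>card H\<close> rather than \<open>1\<close> at \<open>r = 0\<close>.\<close>

lemma chi_symmetric_eq_synthesis:
  assumes R: "orbit_representatives H orbit_domain R" and f: "chi_symmetric H \<chi> f"
  shows "f = synthesis R (\<lambda>r. f r / u_elt H \<chi> r r)"
  by (rule chi_symmetric_eqI[OF R f synthesis_symmetric])
    (simp add: synthesis_representative[OF R] u_elt_self_nonzero[OF R])

text \<open>All four cases of the definition of \<^const>\<open>strong_uncertainty\<close> amount to the same bound on the
  numbers of orbits in the two supports; they differ only in how often the orbit \<open>{0}\<close>, of size \<open>1\<close>
  instead of \<open>|H|\<close>, is counted.\<close>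

lemma strong_uncertainty_iff:
  assumes R: "orbit_representatives H orbit_domain R" and S: "orbit_representatives H orbit_domain S"
  shows "strong_uncertainty H \<chi> \<longleftrightarrow>
    (\<forall>f. f \<noteq> (\<lambda>_. 0) \<and> chi_symmetric H \<chi> f \<longrightarrow>
      card R + 1 \<le> card {r \<in> R. f r \<noteq> 0} + card {s \<in> S. fourier f (eps_char s) \<noteq> 0})"
  unfolding strong_uncertainty_def
proof (intro all_cong)
  fix f assume "f \<noteq> (\<lambda>_. 0) \<and> chi_symmetric H \<chi> f"
  then have f: "chi_symmetric H \<chi> f"
    by blast
  let ?F = "\<lambda>a. fourier f (eps_char a)"
  let ?h = "card H" and ?m = "card (R - {0})"
  have "f (h * a) \<noteq> 0 \<longleftrightarrow> f a \<noteq> 0" if "h \<in> H" for h a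
    using f that \<chi>_nonzero by (auto simp: chi_symmetric_def)
  then obtain k where k: "card {r \<in> R. f r \<noteq> 0} = k + (if f 0 = 0 then 0 else 1)"
    "card (gr_supp f) = ?h * k + (if f 0 = 0 then 0 else 1)"
    using card_support[OF R, of f] chi_symmetric_zero[OF f] unfolding gr_supp_def by blast
  have "?F (h * a) \<noteq> 0 \<longleftrightarrow> ?F a \<noteq> 0" if "h \<in> H" for h a
    using fourier_mult[OF f that, of a] \<chi>_nonzero[OF that] by (metis mult_eq_0_iff)
  then obtain l where l: "card {s \<in> S. ?F s \<noteq> 0} = l + (if ?F 0 = 0 then 0 else 1)"
    "card (fourier_supp f) = ?h * l + (if ?F 0 = 0 then 0 else 1)"
    using card_support[OF S, of ?F] fourier_zero[OF f] unfolding card_fourier_supp by blast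
  have scale: "?h * x \<le> ?h * y \<longleftrightarrow> x \<le> y" for x y
    using card_H_pos by simp
  have sum: "?h * (k + l) = ?h * k + ?h * l"
    by (rule distrib_left)
  have card: "CARD('a) = ?h * ?m + 1"
    by (rule card_field_eq[OF R])
  show "(if \<not> trivial_character H \<chi> then CARD('a) + ?h - 1
           else if f 0 = 0 \<and> ?F 0 = 0 then CARD('a) + 2 * ?h - 1
           else if f 0 = 0 \<or> ?F 0 = 0 then CARD('a) + ?h else CARD('a) + 1)
        \<le> card (gr_supp f) + card (fourier_supp f) \<longleftrightarrow>
      card R + 1 \<le> card {r \<in> R. f r \<noteq> 0} + card {s \<in> S. ?F s \<noteq> 0}"
  proof (cases "trivial_character H \<chi>")
    case False
    then have "f 0 = 0" "?F 0 = 0"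
      using f chi_symmetric_zero fourier_zero by blast+
    then show ?thesis
      using False scale[of "?m + 1" "k + l"]
      by (simp add: card_representatives[OF R] card k l sum add_ac)
  next
    case True
    \<comment> \<open>Writing \<open>h\<close> and \<open>m\<close> for \<open>?h\<close> and
      \<open>?m\<close>, the three bounds are \<open>h * (m + 2)\<close>,
      \<open>h * (m + 1) + 1\<close> and \<open>h * m + 2\<close>, against
      \<open>h * (k + l)\<close> plus \<open>0\<close>, \<open>1\<close> and \<open>2\<close>.
      Cancelling \<open>h\<close> leaves \<open>k + l\<close> at least \<open>m + 2\<close>,
      \<open>m + 1\<close> and \<open>m\<close>, which matches \<open>card R = m + 1\<close> in each
      case.\<close>
    have "?h * (?m + 2) = 2 * ?h + ?h * ?m"
      by (simp add: distrib_left)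
    from scale[of "?m + 2" "k + l", unfolded this]
    have "2 * ?h + ?h * ?m \<le> ?h * (k + l) \<longleftrightarrow> ?m + 2 \<le> k + l" .
    with True show ?thesis
      using scale[of "?m + 1" "k + l"] scale[of "?m" "k + l"]
      by (simp add: card_representatives[OF R] card k l sum add_ac)
  qed
qed

end

theorem proposition4p8:
  fixes H :: "'a::finite_field set" and \<chi> :: "'a \<Rightarrow> complex"
    and R S :: "'a set" and M :: "complex mat"
  assumes "mult_subgroup H"
    and "mult_character H \<chi>"
    and "orbit_representatives H (if trivial_character H \<chi> then UNIV else UNIV - {0}) R"
    and "orbit_representatives H (if trivial_character H \<chi> then UNIV else UNIV - {0}) S"
    and "compressed_fourier_matrix H \<chi> R S M"
  shows "strong_uncertainty H \<chi> \<longleftrightarrow> nonvanishing_minors M"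
proof -
  interpret multiplicative_character H \<chi>
    using assms(1,2) by unfold_locales
  have R: "orbit_representatives H orbit_domain R" and S: "orbit_representatives H orbit_domain S"
    using assms(3,4) by (simp_all only: orbit_domain_def)
  define a where "a r s = char_extend (eps_char s) (u_elt H \<chi> r)" for r s
  obtain rs ss where lists: "distinct rs" "set rs = R" "distinct ss" "set ss = S"
    and M: "M = mat (length rs) (length ss) (\<lambda>(i, j). a (rs ! i) (ss ! j))"
    using assms(5) by (auto simp: compressed_fourier_matrix_def a_def)
  have "length rs = length ss"
    using card_representatives_eq[OF R S] lists by (metis distinct_card)
  then have minors: "nonvanishing_minors M \<longleftrightarrow>
      (\<forall>c. (\<exists>r\<in>R. c r \<noteq> 0) \<longrightarrow>
        card R + 1 \<le> card {r \<in> R. c r \<noteq> 0} + card {s \<in> S. (\<Sum>r\<in>R. c r * a r s) \<noteq> 0})"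
    unfolding M using nonvanishing_minors_iff_indexed_supports[of rs ss a] lists by simp
  define bound where "bound f \<longleftrightarrow> f \<noteq> (\<lambda>_. 0) \<longrightarrow>
      card R + 1 \<le> card {r \<in> R. f r \<noteq> 0} + card {s \<in> S. fourier f (eps_char s) \<noteq> 0}"
    for f :: "'a \<Rightarrow> complex"
  have synthesis_nz: "synthesis R c r \<noteq> 0 \<longleftrightarrow> c r \<noteq> 0" if "r \<in> R" for c r
    using that by (simp add: synthesis_representative[OF R] u_elt_self_nonzero[OF R])
  have synthesis_neq: "synthesis R c \<noteq> (\<lambda>_. 0) \<longleftrightarrow> (\<exists>r\<in>R. c r \<noteq> 0)" for c
  proof -
    \<comment> \<open>The zero function is itself \<open>\<chi>\<close>-symmetric, so agreement with
      it on \<open>R\<close> suffices.\<close>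
    have "synthesis R c = (\<lambda>_. 0) \<longleftrightarrow> (\<forall>r\<in>R. synthesis R c r = 0)"
      using chi_symmetric_eqI[OF R synthesis_symmetric[of R c], of "\<lambda>_. 0"]
      by (auto simp: chi_symmetric_def)
    then show ?thesis
      using synthesis_nz by blast
  qed
  have bound: "bound (synthesis R c) \<longleftrightarrow> ((\<exists>r\<in>R. c r \<noteq> 0) \<longrightarrow>
      card R + 1 \<le> card {r \<in> R. c r \<noteq> 0} + card {s \<in> S. (\<Sum>r\<in>R. c r * a r s) \<noteq> 0})" for c
  proof -
    have "{r \<in> R. synthesis R c r \<noteq> 0} = {r \<in> R. c r \<noteq> 0}"
      using synthesis_nz by blast
    then show ?thesis
      by (simp only: bound_def synthesis_neq fourier_synthesis a_def)
  qed
  have "strong_uncertainty H \<chi> \<longleftrightarrow> (\<forall>f. chi_symmetric H \<chi> f \<longrightarrow> bound f)"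
    unfolding strong_uncertainty_iff[OF R S] bound_def by blast
  \<comment> \<open>Symmetric functions and coefficient vectors can be exchanged under the
    quantifier: every synthesis is symmetric, and every symmetric function is a synthesis.\<close>
  also have "\<dots> \<longleftrightarrow> (\<forall>c. bound (synthesis R c))"
    using synthesis_symmetric chi_symmetric_eq_synthesis[OF R] by metis
  finally show ?thesis
    by (simp only: bound minors)
qed

end
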